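(* Let $\mathcal S\subset\mathbb{R}^{\mathcal M}$, $\mathbf u^*\in\mathcal S$ and the local parametrization $U:\mathcal Q^0\subset\mathbb R^q\to\mathbb R^{\mathcal M}$ of $\mathcal S$ with $U(\boldsymbol 0)=\mathbf u^*$ be as in the context, and for small $r>0$ let $\mathcal S^{*,r}=\{U(\boldsymbol\nu)-\mathbf u^*:\boldsymbol\nu\in\mathcal B(\boldsymbol 0,r)\}$. Then the centered manifold has locally a latent (sensing) dimension equal to $q$ around $\mathbf u^*$: for all sufficiently small $r>0$, \[ n_s(\mathcal S^{*,r})=q . \]
   Context: Setting. $\mathcal S$ is an embedded submanifold of dimension $q$ of $X=\mathbb R^{\mathcal M}$ ($\mathcal M\gg q$), and $\mathbf u^*\in\mathcal S$. $U:\mathcal Q^0\to\mathbb R^{\mathcal M}$ is the inverse of a chart of $\mathcal S$ around $\mathbf u^*$: $\mathcal Q^0\subset\mathbb R^q$ is open and contains the closed unit ball $\mathcal B(\boldsymbol 0,1)$, $U$ is a homeomorphism onto an open subset of $\mathcal S$, and $U(\boldsymbol 0)=\mathbf u^*$. Standing assumptions: $U$ is of class $C^3$; at every point of $\mathcal Q^0$ the Jacobian $\mathbf J_U(\boldsymbol\nu)\in\mathbb R^{\mathcal M\times q}$ has rank $q$, and the second fundamental form has maximal rank, i.e. the components of the second derivatives $\partial_{\nu_j}\partial_{\nu_\ell}U$, $1\le j\le\ell\le q$, orthogonal to the tangent space $\mathrm{Range}(\mathbf J_U(\boldsymbol\nu))$ span a space of dimension $\tfrac12q(q+1)$. $\mathcal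 B(\boldsymbol 0,r)$ denotes the closed Euclidean ball of radius $r$ in $\mathbb R^q$. Sensing numbers. For a set $\mathcal K\subset X$ and $n\in\mathbb N$, \[ s_n(\mathcal K):=\inf_{\substack{D\in\mathcal C(\mathbb R^n,X)\\ \ell_1,\dots,\ell_n\in X'}}\ \sup_{u\in\mathcal K}\big\|u-D(\ell_1(u),\dots,\ell_n(u))\big\|_X, \] where $\mathcal C(\mathbb R^n,X)$ is the set of continuous maps and $X'$ is the (continuous) dual of $X$. The associated minimal latent dimension is $n_s(\mathcal K):=\min\{n\in\mathbb N: s_n(\mathcal K)=0\}$. *)

theory Defs
  imports "HOL-Analysis.Analysis"
begin

section \<open>Regularity and parametrized submanifolds\<close>

text \<open>
  Class \<open>C\<^sup>k\<close> on an open set \<open>Q\<close>, by iterating directional derivatives. In finite dimension this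
  is equivalent to the existence and continuity of all partial derivatives up to order \<open>k\<close>.
\<close>

primrec C_class_on ::
    "nat \<Rightarrow> 'a::euclidean_space set \<Rightarrow> ('a \<Rightarrow> 'b::real_normed_vector) \<Rightarrow> bool" where
  "C_class_on 0 Q f \<longleftrightarrow> continuous_on Q f"
| "C_class_on (Suc k) Q f \<longleftrightarrow>
     (\<forall>x\<in>Q. f differentiable (at x)) \<and>
     (\<forall>v. C_class_on k Q (\<lambda>x. frechet_derivative f (at x) v))"

text \<open>Inverse of a chart of \<open>S\<close>, of class \<open>C\<^sup>k\<close>.\<close>

definition local_parametrization ::
    "nat \<Rightarrow> (real^'m) set \<Rightarrow> (real^'q) set \<Rightarrow> (real^'q \<Rightarrow> real^'m) \<Rightarrow> bool" where
  "local_parametrization k S Q U \<longleftrightarrow>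
     open Q \<and> C_class_on k Q U \<and>
     (\<forall>\<nu>\<in>Q. rank (jacobian U (at \<nu>)) = CARD('q)) \<and>
     openin (top_of_set S) (U ` Q) \<and>
     (\<exists>V. homeomorphism Q (U ` Q) U V)"

text \<open>
  The dimension of the submanifold is \<open>CARD('q)\<close>. For \<open>k = 0\<close> the definition is not meaningful,
  as the Jacobian need not exist.
\<close>

definition embedded_submanifold :: "nat \<Rightarrow> 'q::finite itself \<Rightarrow> (real^'m) set \<Rightarrow> bool" where
  "embedded_submanifold k (_ :: 'q itself) S \<longleftrightarrow>
     (\<forall>p\<in>S. \<exists>(Q :: (real^'q) set) U. p \<in> U ` Q \<and> local_parametrization k S Q U)"

section \<open>Second fundamental form\<close>

definition partial_deriv :: "'q \<Rightarrow> (real^'q \<Rightarrow> real^'m) \<Rightarrow> real^'q \<Rightarrow> real^'m" where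
  "partial_deriv j f \<nu> = frechet_derivative f (at \<nu>) (axis j 1)"

definition tangent_space :: "(real^'q \<Rightarrow> real^'m) \<Rightarrow> real^'q \<Rightarrow> (real^'m) set" where
  "tangent_space U \<nu> = range (\<lambda>h. jacobian U (at \<nu>) *v h)"

definition normal_component :: "'a::euclidean_space set \<Rightarrow> 'a \<Rightarrow> 'a" where
  "normal_component T v = (THE w. w \<in> T\<^sup>\<bottom> \<and> v - w \<in> T)"

lemma normal_component_unique:
  fixes T :: "'a::euclidean_space set"
  assumes T: "subspace T"
  shows "\<exists>!w. w \<in> T\<^sup>\<bottom> \<and> v - w \<in> T"
proof -
  have span_T: "span T = T"
    using T by (simp add: span_eq_iff)
  obtain y z where y: "y \<in> span T" and z: "\<And>w. w \<in> span T \<Longrightarrow> orthogonal z w" and v: "v = y + z"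
    using orthogonal_subspace_decomp_exists[of T v] by blast
  have "z \<in> T\<^sup>\<bottom> \<and> v - z \<in> T"
    using y z v by (auto simp: orthogonal_comp_def orthogonal_commute span_T)
  moreover have "w = w'" if "w \<in> T\<^sup>\<bottom> \<and> v - w \<in> T" "w' \<in> T\<^sup>\<bottom> \<and> v - w' \<in> T" for w w'
  proof -
    have "w - w' \<in> T\<^sup>\<bottom>"
      using that subspace_diff[OF subspace_orthogonal_comp] by blast
    moreover have "(v - w') - (v - w) \<in> T"
      using that subspace_diff[OF T] by blast
    ultimately have "orthogonal (w - w') (w - w')"
      by (simp add: orthogonal_comp_def)
    then show ?thesis
      by (simp add: orthogonal_self)
  qed
  ultimately show ?thesis
    by blast
qed

text \<open>
  The index type carries no order, so all pairs \<open>(j, l)\<close> are taken instead of those with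
  \<open>j \<le> l\<close>; by symmetry of the second derivative of a \<open>C\<^sup>2\<close> map the set of vectors is the same.
\<close>

definition second_fundamental_form_max_rank ::
    "(real^'q \<Rightarrow> real^'m) \<Rightarrow> real^'q \<Rightarrow> bool" where
  "second_fundamental_form_max_rank U \<nu> \<longleftrightarrow>
     dim (span {normal_component (tangent_space U \<nu>) (partial_deriv j (partial_deriv l U) \<nu>) | j l. True})
       = CARD('q) * (CARD('q) + 1) div 2"

section \<open>Sensing numbers\<close>

text \<open>
  \<open>\<real>\<^sup>n\<close> is \<open>Euclidean_space n\<close>, the sequences vanishing from index \<open>n\<close> on. The values lie in
  \<open>[0, \<infinity>]\<close>, so that the supremum is \<open>\<infinity>\<close> when the error is unbounded and \<open>0\<close> over the empty set.
\<close>

definition sensing_number :: "nat \<Rightarrow> 'a::real_normed_vector set \<Rightarrow> ennreal" where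
  "sensing_number n K =
     (INF (D, \<phi>) \<in> {D :: (nat \<Rightarrow> real) \<Rightarrow> 'a. continuous_map (Euclidean_space n) euclidean D}
                   \<times> (UNIV :: (nat \<Rightarrow> 'a \<Rightarrow>\<^sub>L real) set).
        SUP u\<in>K. ennreal (norm (u - D (\<lambda>i. if i < n then blinfun_apply (\<phi> i) u else 0))))"

text \<open>The minimum over the empty set is \<open>\<infinity>\<close>.\<close>

definition latent_sensing_dim :: "'a::real_normed_vector set \<Rightarrow> enat" where
  "latent_sensing_dim K = Inf (enat ` {n. sensing_number n K = 0})"

end

theory Submission
  imports Defs
begin

text \<open>
  Let \<open>w \<nu> = U \<nu> - ustar\<close>, and let \<open>q\<close> be the dimension of the parameter space.

  \<^emph>\<open>Dimension \<open>q\<close> suffices.\<close> The derivative of \<open>w\<close> at \<open>0\<close> has full rank, so it has a linear left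
  inverse \<open>L\<close>. The map \<open>L \<circ> w\<close> between spaces of dimension \<open>q\<close> is continuously differentiable with
  derivative the identity at \<open>0\<close>, hence injective on a small ball \<open>B\<close>. As \<open>B\<close> is compact, \<open>L \<circ> w\<close> has
  a continuous inverse on the image of \<open>B\<close>, which Dugundji's theorem extends to a continuous
  \<open>H\<close> from the whole space into \<open>B\<close>. The \<open>q\<close> coordinates of \<open>L u\<close> are the sensors and
  \<open>D = w \<circ> H\<close> is an exact decoder (\<open>locally_injective_linear_image\<close>,
  \<open>continuous_left_inverse_on_cball\<close>, \<open>sensing_number_eq_0\<close>).

  \<^emph>\<open>Fewer than \<open>q\<close> sensors leave a positive error.\<close> The map \<open>P = H \<circ> L\<close> is a continuous left inverse of
  \<open>w\<close>. If the error with \<open>n < q\<close> sensors could be made arbitrarily small, then composing a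
  good decoder with \<open>P\<close> would give a map \<open>E\<close> such that \<open>x \<mapsto> E (\<phi> (w x))\<close> is uniformly close to the
  identity on \<open>B\<close> and factors through an \<open>n\<close>-dimensional space. Approximate \<open>E\<close> by a
  polynomial. By Brouwer's theorem the composition still covers a neighbourhood of \<open>0\<close>, while a
  smooth image of a lower-dimensional space is a null set, which is absurd
  (\<open>near_identity_not_through_negligible\<close>, \<open>sensing_number_neq_0\<close>).

  Both halves work for every \<open>r\<close> such that \<open>L \<circ> w\<close> is injective on \<open>cball 0 r\<close>.
\<close>

section \<open>Maps that factor through a null set\<close>

text \<open>
  For small \<open>y\<close> a fixed point of \<open>x \<mapsto> x - g x + y\<close> solves \<open>g x = y\<close>.
\<close>

lemma near_identity_covers_ball:
  fixes g :: "'a::euclidean_space \<Rightarrow> 'a"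
  assumes "0 < r" and cont: "continuous_on (cball 0 r) g"
    and close: "\<And>x. x \<in> cball 0 r \<Longrightarrow> norm (g x - x) \<le> s"
  shows "cball 0 (r - s) \<subseteq> g ` cball 0 r"
proof
  fix y :: 'a assume y: "y \<in> cball 0 (r - s)"
  define h where "h x = x - g x + y" for x
  have "h ` cball 0 r \<subseteq> cball 0 r"
  proof (clarsimp simp: h_def)
    fix x :: 'a assume "norm x \<le> r"
    then have "norm (x - g x) \<le> s"
      using close[of x] by (simp add: norm_minus_commute)
    then show "norm (x - g x + y) \<le> r"
      using norm_triangle_ineq[of "x - g x" y] y by simp
  qed
  moreover have "continuous_on (cball 0 r) h"
    unfolding h_def by (intro continuous_intros cont)
  ultimately obtain x where "x \<in> cball 0 r" "h x = x"
    using brouwer_ball[OF \<open>0 < r\<close>, of 0 h] by blast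
  then show "y \<in> g ` cball 0 r"
    by (auto simp: h_def intro!: image_eqI[of _ _ x])
qed

text \<open>
  A continuous image of a null set may have interior, as a space-filling curve shows; so \<open>E\<close> is first
  replaced by a polynomial, whose images of null sets are null.
\<close>

lemma near_identity_not_through_negligible:
  fixes A E :: "'a::euclidean_space \<Rightarrow> 'a"
  assumes "0 < r" and A: "continuous_on (cball 0 r) A" and E: "continuous_on (A ` cball 0 r) E"
    and N: "negligible (A ` cball 0 r)"
  shows "\<exists>x\<in>cball 0 r. r / 2 < norm (E (A x) - x)"
proof (rule ccontr)
  assume "\<not> ?thesis"
  then have close: "norm (E (A x) - x) \<le> r / 2" if "x \<in> cball 0 r" for x
    using that by force
  let ?K = "A ` cball 0 r"
  have "compact ?K"
    by (simp add: A compact_continuous_image)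
  then obtain p where p: "polynomial_function p" "\<And>z. z \<in> ?K \<Longrightarrow> norm (E z - p z) < r / 4"
    using Stone_Weierstrass_polynomial_function[OF _ E, of "r / 4"] \<open>0 < r\<close> by auto
  have "continuous_on (cball 0 r) (p \<circ> A)"
    by (intro continuous_on_compose A continuous_on_polymonial_function p)
  moreover have "norm ((p \<circ> A) x - x) \<le> 3 * r / 4" if x: "x \<in> cball 0 r" for x
  proof -
    have "norm (p (A x) - E (A x)) < r / 4"
      using p(2)[of "A x"] x by (simp add: norm_minus_commute)
    then show ?thesis
      using close[OF x] norm_triangle_ineq[of "p (A x) - E (A x)" "E (A x) - x"] by simp
  qed
  ultimately have "cball 0 (r - 3 * r / 4) \<subseteq> (p \<circ> A) ` cball 0 r"
    by (rule near_identity_covers_ball[OF \<open>0 < r\<close>])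
  moreover have "negligible (p ` ?K)"
    by (rule negligible_differentiable_image_negligible[OF _ N differentiable_on_polynomial_function])
      (simp_all add: p)
  ultimately have "negligible (cball 0 (r / 4) :: 'a set)"
    by (auto simp: image_comp intro: negligible_subset)
  moreover have "interior (cball 0 (r / 4) :: 'a set) \<noteq> {}"
    using \<open>0 < r\<close> by simp
  ultimately show False
    using open_not_negligible[OF open_interior] negligible_subset interior_subset by blast
qed

section \<open>Bounds on sensing numbers\<close>

lemma continuous_map_Euclidean_space_iff:
  "continuous_map (Euclidean_space n) euclidean D \<longleftrightarrow> continuous_on {x. \<forall>i\<ge>n. x i = 0} D"
  by (simp add: Euclidean_space_def euclidean_product_topology)

lemma sensing_number_eq_0:
  fixes L :: "'x::real_normed_vector \<Rightarrow> 'a::euclidean_space"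
  assumes L: "bounded_linear L" and D: "continuous_on UNIV D"
    and exact: "\<And>u. u \<in> K \<Longrightarrow> D (L u) = u"
  shows "sensing_number DIM('a) K = 0"
proof -
  obtain b where b: "bij_betw b {0..<DIM('a)} (Basis :: 'a set)"
    using ex_bij_betw_nat_finite[OF finite_Basis] by blast
  define \<phi> where "\<phi> i = Blinfun (\<lambda>u. L u \<bullet> b i)" for i
  have \<phi>: "blinfun_apply (\<phi> i) u = L u \<bullet> b i" for i u
    unfolding \<phi>_def
    by (simp add: bounded_linear_Blinfun_apply bounded_linear_compose[OF bounded_linear_inner_left L])
  define F where "F x = D (\<Sum>i<DIM('a). x i *\<^sub>R b i)" for x :: "nat \<Rightarrow> real"
  have "continuous_on {x. \<forall>i\<ge>DIM('a). x i = 0} F"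
    unfolding F_def
    by (intro continuous_on_compose2[OF D] continuous_intros
          continuous_on_subset[OF continuous_on_product_coordinates]) auto
  moreover have "F (\<lambda>i. if i < DIM('a) then blinfun_apply (\<phi> i) u else 0) = u" if "u \<in> K" for u
  proof -
    have "(\<Sum>i<DIM('a). (L u \<bullet> b i) *\<^sub>R b i) = (\<Sum>c\<in>Basis. (L u \<bullet> c) *\<^sub>R c)"
      using sum.reindex_bij_betw[OF b, of "\<lambda>c. (L u \<bullet> c) *\<^sub>R c"] by (simp add: lessThan_atLeast0)
    then show ?thesis
      using exact[OF that] by (simp add: F_def \<phi> euclidean_representation)
  qed
  then have "(SUP u\<in>K. ennreal (norm (u - F (\<lambda>i. if i < DIM('a) then blinfun_apply (\<phi> i) u else 0)))) \<le> 0"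
    by (intro SUP_least) simp
  ultimately have "sensing_number DIM('a) K \<le> 0"
    unfolding sensing_number_def
    by (intro INF_lower2[of "(F, \<phi>)"]) (simp_all add: continuous_map_Euclidean_space_iff)
  then show ?thesis
    by simp
qed

lemma small_sensing_number_decoder:
  assumes "sensing_number n K < ennreal e"
  obtains D and \<phi> :: "nat \<Rightarrow> 'a::real_normed_vector \<Rightarrow>\<^sub>L real" where "continuous_on {x. \<forall>i\<ge>n. x i = 0} D"
    and "\<And>u. u \<in> K \<Longrightarrow>
           norm (u - D (\<lambda>i. if i < n then blinfun_apply (\<phi> i) u else 0)) < e"
proof -
  obtain z where z: "z \<in> {D. continuous_map (Euclidean_space n) euclidean D} \<times> UNIV"
    "(case z of (D, \<phi>) \<Rightarrow>
        SUP u\<in>K. ennreal (norm (u - D (\<lambda>i. if i < n then blinfun_apply (\<phi> i) u else 0)))) < ennreal e"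
    using assms unfolding sensing_number_def INF_less_iff by blast
  obtain D \<phi> where Dphi: "z = (D, \<phi>)"
    by fastforce
  have D: "continuous_on {x. \<forall>i\<ge>n. x i = 0} D"
    and lt: "(SUP u\<in>K. ennreal (norm (u - D (\<lambda>i. if i < n then blinfun_apply (\<phi> i) u else 0)))) < ennreal e"
    using z by (simp_all add: Dphi continuous_map_Euclidean_space_iff)
  have "norm (u - D (\<lambda>i. if i < n then blinfun_apply (\<phi> i) u else 0)) < e" if "u \<in> K" for u
    using le_less_trans[OF SUP_upper[OF that] lt] by (simp add: ennreal_less_iff)
  with D show ?thesis
    using that by blast
qed

lemma uniform_continuity_around_compact:
  fixes P :: "'x::euclidean_space \<Rightarrow> 'b::metric_space"
  assumes P: "continuous_on UNIV P" and K: "compact K" and "0 < s"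
  obtains e where "0 < e" and "\<And>u v. u \<in> K \<Longrightarrow> dist u v < e \<Longrightarrow> dist (P u) (P v) < s"
proof -
  obtain R where R: "\<And>u. u \<in> K \<Longrightarrow> norm u \<le> R"
    using compact_imp_bounded[OF K] by (auto simp: bounded_iff)
  have "uniformly_continuous_on (cball 0 (R + 1)) P"
    by (intro compact_uniformly_continuous continuous_on_subset[OF P]) auto
  then obtain d where d: "0 < d"
    "\<And>u v. u \<in> cball 0 (R + 1) \<Longrightarrow> v \<in> cball 0 (R + 1) \<Longrightarrow> dist v u < d \<Longrightarrow> dist (P v) (P u) < s"
    using \<open>0 < s\<close> unfolding uniformly_continuous_on_def by metis
  have "dist (P u) (P v) < s" if "u \<in> K" "dist u v < min d 1" for u v
  proof -
    have "norm v \<le> norm u + dist u v"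
      by (metis dist_commute dist_norm norm_triangle_sub)
    then show ?thesis
      using that R[OF that(1)] d(2)[of v u] by auto
  qed
  then show ?thesis
    using that[of "min d 1"] d(1) by auto
qed

text \<open>
  The sensor space of dimension \<open>n\<close> is placed inside the parameter space as a span of \<open>n\<close> basis vectors;
  since \<open>n\<close> is less than the dimension, it lies in a coordinate hyperplane and is a null set.
\<close>

lemma sensing_number_neq_0:
  fixes w :: "'a::euclidean_space \<Rightarrow> 'x::euclidean_space"
  assumes "0 < r" and w: "continuous_on (cball 0 r) w"
    and P: "continuous_on UNIV P" and Pw: "\<And>x. x \<in> cball 0 r \<Longrightarrow> P (w x) = x"
    and n: "n < DIM('a)"
  shows "sensing_number n (w ` cball 0 r) \<noteq> 0"
proof
  assume "sensing_number n (w ` cball 0 r) = 0"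
  have "compact (w ` cball 0 r)"
    by (simp add: compact_continuous_image w)
  then obtain e where "0 < e"
    and e: "\<And>u v. u \<in> w ` cball 0 r \<Longrightarrow> dist u v < e \<Longrightarrow> dist (P u) (P v) < r / 2"
    using uniform_continuity_around_compact[OF P, of _ "r / 2"] \<open>0 < r\<close> half_gt_zero by metis
  then have "sensing_number n (w ` cball 0 r) < ennreal e"
    using \<open>sensing_number n (w ` cball 0 r) = 0\<close> by simp
  then obtain D and \<phi> :: "nat \<Rightarrow> 'x \<Rightarrow>\<^sub>L real" where D: "continuous_on {x. \<forall>i\<ge>n. x i = 0} D"
    and err: "\<And>u. u \<in> w ` cball 0 r \<Longrightarrow>
           norm (u - D (\<lambda>i. if i < n then blinfun_apply (\<phi> i) u else 0)) < e"
    using small_sensing_number_decoder by blast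
  obtain b where b: "bij_betw b {0..<DIM('a)} (Basis :: 'a set)"
    using ex_bij_betw_nat_finite[OF finite_Basis] by blast
  have b_Basis: "b i \<in> Basis" if "i \<le> n" for i
    using b n that by (auto simp: bij_betw_def)
  have b_inner: "b i \<bullet> b j = (if i = j then 1 else 0)" if "i \<le> n" "j \<le> n" for i j
  proof -
    have "b i = b j \<longleftrightarrow> i = j"
      using b n that by (auto simp: bij_betw_def inj_on_eq_iff)
    then show ?thesis
      using b_Basis that by (simp add: inner_Basis)
  qed
  define A where "A x = (\<Sum>i<n. blinfun_apply (\<phi> i) (w x) *\<^sub>R b i)" for x
  define E where "E y = P (D (\<lambda>i. if i < n then y \<bullet> b i else 0))" for y
  have A_inner: "A x \<bullet> b j = (if j < n then blinfun_apply (\<phi> j) (w x) else 0)" if "j \<le> n" for x j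
  proof -
    have "A x \<bullet> b j = (\<Sum>i<n. blinfun_apply (\<phi> i) (w x) * (b i \<bullet> b j))"
      by (simp add: A_def inner_sum_left)
    also have "\<dots> = (\<Sum>i<n. if i = j then blinfun_apply (\<phi> i) (w x) else 0)"
      using that by (intro sum.cong) (auto simp: b_inner)
    finally show ?thesis
      by simp
  qed
  have "continuous_on (cball 0 r) A"
    unfolding A_def by (intro continuous_intros w)
  moreover have "continuous_on UNIV (\<lambda>y. if i < n then y \<bullet> b i else 0)" for i
    by (cases "i < n") (simp_all add: continuous_intros)
  then have "continuous_on UNIV (\<lambda>y. \<lambda>i. if i < n then y \<bullet> b i else 0)"
    by (intro continuous_on_coordinatewise_then_product)
  then have "continuous_on (A ` cball 0 r) E"
    unfolding E_def
    by (intro continuous_on_compose2[OF P] continuous_on_compose2[OF D])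
      (auto intro: continuous_on_subset)
  moreover have "A ` cball 0 r \<subseteq> {y. y \<bullet> b n = 0}"
    by (auto simp: A_inner)
  then have "negligible (A ` cball 0 r)"
    using negligible_standard_hyperplane[OF b_Basis[OF order_refl]] negligible_subset by blast
  ultimately obtain x where x: "x \<in> cball 0 r" "r / 2 < norm (E (A x) - x)"
    using near_identity_not_through_negligible[OF \<open>0 < r\<close>] by blast
  have "E (A x) = P (D (\<lambda>i. if i < n then blinfun_apply (\<phi> i) (w x) else 0))"
    by (simp add: E_def A_inner cong: if_cong)
  then have "dist (P (w x)) (E (A x)) < r / 2"
    using e[of "w x"] err[of "w x"] x(1) by (simp add: dist_norm)
  then show False
    using x Pw by (simp add: dist_norm norm_minus_commute)
qed

section \<open>Local injectivity of a linear image of the parametrization\<close>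

text \<open>
  The inverse is continuous since its domain is the image of a compact set. Extending it
  with values in the convex ball lets it be composed with maps that are continuous on that ball only.
\<close>

lemma continuous_left_inverse_on_cball:
  fixes f :: "'a::euclidean_space \<Rightarrow> 'b::euclidean_space"
  assumes "0 \<le> r" and f: "continuous_on (cball 0 r) f" and inj: "inj_on f (cball 0 r)"
  obtains H where "continuous_on UNIV H" "H ` UNIV \<subseteq> cball 0 r"
    and "\<And>x. x \<in> cball 0 r \<Longrightarrow> H (f x) = x"
proof -
  define h where "h = the_inv_into (cball 0 r) f"
  have hf: "h (f x) = x" if "x \<in> cball 0 r" for x
    unfolding h_def using the_inv_into_f_f[OF inj that] .
  have "continuous_on (f ` cball 0 r) h"
    using continuous_on_inv[OF f] hf by auto
  moreover have "closedin (top_of_set UNIV) (f ` cball 0 r)"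
    by (simp add: closed_closedin[symmetric] compact_continuous_image compact_imp_closed f)
  moreover have "h \<in> f ` cball 0 r \<rightarrow> cball 0 r"
    using hf by auto
  ultimately obtain H where "continuous_on UNIV H" "H \<in> UNIV \<rightarrow> cball 0 r"
    "\<And>y. y \<in> f ` cball 0 r \<Longrightarrow> H y = h y"
    using Dugundji[of "cball 0 r" UNIV "f ` cball 0 r" h] \<open>0 \<le> r\<close> by (auto simp: image_subset_iff_funcset)
  with hf show ?thesis
    by (intro that) auto
qed

text \<open>
  The inverse function argument needs the derivative to be continuous in operator norm. That norm is
  at most the sum over a basis of the norms of the directional derivatives, so their continuity is
  enough.
\<close>

lemma locally_injective_linear_image:
  fixes U :: "'a::euclidean_space \<Rightarrow> 'b::euclidean_space" and L :: "'b \<Rightarrow> 'a"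
  assumes Q: "open Q" "a \<in> Q" and U: "\<And>x. x \<in> Q \<Longrightarrow> (U has_derivative U' x) (at x)"
    and cont: "\<And>v. isCont (\<lambda>x. U' x v) a"
    and L: "linear L" and LU: "\<And>v. L (U' a v) = v"
  obtains r where "0 < r" "ball a r \<subseteq> Q" "inj_on (\<lambda>x. L (U x)) (ball a r)"
proof -
  have bL: "bounded_linear L"
    using L by (simp add: linear_conv_bounded_linear)
  have der: "((\<lambda>x. L (U x)) has_derivative (\<lambda>v. L (U' x v))) (at x)" if "x \<in> Q" for x
    using bounded_linear.has_derivative[OF bL U[OF that]] .
  have lim: "((\<lambda>x. U' x v) \<longlongrightarrow> U' a v) (nhds a)" for v
    using cont[of v] tendsto_at_iff_tendsto_nhds[of "\<lambda>x. U' x v" a] by (simp add: isCont_def)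
  have small: "\<exists>d>0. \<forall>x. dist a x < d \<longrightarrow> onorm (\<lambda>v. L (U' x v) - L (U' a v)) < e" if "0 < e" for e
  proof -
    have "((\<lambda>x. \<Sum>i\<in>Basis. norm (L (U' x i) - L (U' a i))) \<longlongrightarrow> (\<Sum>i\<in>Basis. norm (L (U' a i) - L (U' a i)))) (nhds a)"
      by (intro tendsto_intros bounded_linear.tendsto[OF bL] lim)
    then have "\<forall>\<^sub>F x in nhds a. (\<Sum>i\<in>Basis. norm (L (U' x i) - L (U' a i))) < e"
      using that by (intro order_tendstoD(2)) simp_all
    moreover have "\<forall>\<^sub>F x in nhds a. x \<in> Q"
      using Q by (rule eventually_nhds_in_open)
    ultimately have "\<forall>\<^sub>F x in nhds a. onorm (\<lambda>v. L (U' x v) - L (U' a v)) < e"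
    proof eventually_elim
      case (elim x)
      have "bounded_linear (\<lambda>v. L (U' x v) - L (U' a v))"
        by (intro bounded_linear_sub has_derivative_bounded_linear[OF der] elim Q)
      from onorm_componentwise[OF this] elim show ?case
        by simp
    qed
    then show ?thesis
      by (auto simp: eventually_nhds_metric dist_commute)
  qed
  have "id \<circ> (\<lambda>v. L (U' a v)) = id"
    by (simp add: LU fun_eq_iff)
  from has_derivative_locally_injective[where f' = "\<lambda>x v. L (U' x v)",
      OF Q(2) Q(1) bounded_linear_ident[folded id_def] this der small]
  obtain r where "0 < r" "ball a r \<subseteq> Q" "inj_on (\<lambda>x. L (U x)) (ball a r)"
    by blast
  then show ?thesis
    by (rule that)
qed

lemma latent_sensing_dim_parametrized_ball:
  fixes w :: "'a::euclidean_space \<Rightarrow> 'x::euclidean_space" and L :: "'x \<Rightarrow> 'a"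
  assumes "0 < r" and w: "continuous_on (cball 0 r) w"
    and L: "linear L" and inj: "inj_on (\<lambda>x. L (w x)) (cball 0 r)"
  shows "latent_sensing_dim (w ` cball 0 r) = enat DIM('a)"
proof -
  have bL: "bounded_linear L"
    using L by (simp add: linear_conv_bounded_linear)
  have "continuous_on (cball 0 r) (\<lambda>x. L (w x))"
    by (intro linear_continuous_on_compose[OF w L])
  then obtain H where H: "continuous_on UNIV H" "H ` UNIV \<subseteq> cball 0 r"
    and HL: "\<And>x. x \<in> cball 0 r \<Longrightarrow> H (L (w x)) = x"
    using continuous_left_inverse_on_cball[OF _ _ inj] \<open>0 < r\<close> by (metis less_imp_le)
  have "continuous_on UNIV (\<lambda>y. w (H y))"
    using H by (intro continuous_on_compose2[OF w H(1)]) auto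
  then have "sensing_number DIM('a) (w ` cball 0 r) = 0"
    by (rule sensing_number_eq_0[OF bL]) (auto simp: HL)
  moreover have "continuous_on UNIV (\<lambda>u. H (L u))"
    by (intro continuous_on_compose2[OF H(1)] linear_continuous_on bL) auto
  then have "DIM('a) \<le> n" if "sensing_number n (w ` cball 0 r) = 0" for n
    using sensing_number_neq_0[OF \<open>0 < r\<close> w, of "\<lambda>u. H (L u)" n] HL that not_le by blast
  ultimately show ?thesis
    unfolding latent_sensing_dim_def by (intro antisym Inf_lower Inf_greatest) auto
qed

theorem mainTheorem1:
  fixes S :: "(real^'m) set"
    and ustar :: "real^'m"
    and Q0 :: "(real^'q) set"
    and U :: "real^'q \<Rightarrow> real^'m"
    and k :: nat
  assumes "k \<ge> 1"
    and "embedded_submanifold k TYPE('q) S"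
    and "ustar \<in> S"
    and "local_parametrization 3 S Q0 U"
    and "cball 0 1 \<subseteq> Q0"
    and "U 0 = ustar"
    and "\<forall>\<nu>\<in>Q0. second_fundamental_form_max_rank U \<nu>"
  shows "\<forall>\<^sub>F r in at_right (0::real).
           latent_sensing_dim ((\<lambda>\<nu>. U \<nu> - ustar) ` cball 0 r) = enat CARD('q)"
proof -
  define U' where "U' x = frechet_derivative U (at x)" for x
  have Q: "open Q0" "0 \<in> Q0"
    using assms(4,5) by (auto simp: local_parametrization_def)
  have U: "(U has_derivative U' x) (at x)" if "x \<in> Q0" for x
    using assms(4) that
    by (simp add: local_parametrization_def numeral_3_eq_3 U'_def frechet_derivative_works)
  have cont: "isCont (\<lambda>x. U' x v) 0" for v
    using assms(4) Q(2)
    by (auto simp: local_parametrization_def numeral_3_eq_3 U'_def intro!: differentiable_imp_continuous_within)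
  have lin: "linear (U' 0)"
    using U[OF Q(2)] by (rule has_derivative_linear)
  have "inj ((*v) (jacobian U (at 0)))"
    using assms(4) Q(2) by (simp add: local_parametrization_def full_rank_injective)
  then have "inj (U' 0)"
    using lin by (simp add: jacobian_def U'_def matrix_vector_mul)
  then obtain L where L: "linear L" "L \<circ> U' 0 = id"
    using linear_injective_left_inverse[OF lin] by blast
  then obtain r0 where r0: "0 < r0" "ball 0 r0 \<subseteq> Q0" "inj_on (\<lambda>x. L (U x)) (ball 0 r0)"
    using locally_injective_linear_image[OF Q U cont L(1)] by (metis comp_apply id_apply)
  have "latent_sensing_dim ((\<lambda>\<nu>. U \<nu> - ustar) ` cball 0 r) = enat CARD('q)" if r: "0 < r" "r < r0" for r
  proof -
    have sub: "cball 0 r \<subseteq> ball (0 :: real^'q) r0"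
      using r by auto
    have "continuous_on (cball 0 r) (\<lambda>\<nu>. U \<nu> - ustar)"
      using sub r0(2) U
      by (intro continuous_intros has_derivative_continuous_on) (blast intro: has_derivative_at_withinI)
    moreover have "inj_on (\<lambda>x. L (U x - ustar)) (cball 0 r)"
      using inj_on_subset[OF r0(3) sub] by (simp add: linear_diff[OF L(1)] inj_on_def)
    ultimately show ?thesis
      using latent_sensing_dim_parametrized_ball[OF r(1) _ L(1)] by simp
  qed
  then show ?thesis
    using r0(1) by (auto simp: eventually_at_right_field)
qed

end
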